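(* Let $L$ be a finite loop. Every pseudocoboundary of $L$ and every pseudococycle of $L$ is a ($2$-)loop-cocycle of $L$ over $\mathbb{Z}_2$.
   Context: A loop is a finite set $L$ with a binary operation having an identity element $e$ and such that for all $a,b\in L$ the equations $ax=b$ and $ya=b$ have unique solutions $x,y\in L$. Let $\mathbb{Z}_2=(\mathbb{F}_2,+)$ (identified with the multiplicative group $\{1,-1\}$) and let $\mathcal{C}^k(L,\mathbb{Z}_2)$ be the abelian group of all functions $L^k\to\mathbb{Z}_2$ under pointwise addition. The coboundary operator $\delta:\mathcal{C}^k(L,\mathbb{Z}_2)\to\mathcal{C}^{k+1}(L,\mathbb{Z}_2)$, $f\mapsto\delta_f$, is $$\delta_f(a_1,\ldots,a_{k+1})=f(a_1,\ldots,a_k)+f(a_2,\ldots,a_{k+1})+\sum_{i=1}^k f(a_1,\ldots,a_ia_{i+1},\ldots,a_{k+1}).$$ Write $\delta^2(f)=\delta(\delta_f)$. Let $\mathcal{Z}^2(L,\mathbb{Z}_2)=\{\psi\in\mathcal{C}^2(L,\mathbb{Z}_2):\delta_\psi=0\}$. A ($2$-)loop-cocycle is a $\psi\in\mathcal{C}^2(L,\mathbb{Z}_2)$ such that $\delta_\psi=\delta^2(f)$ for some $f\in\mathcal{C}^1(L,\mathbb{Z}_2)$. For $h\in L$, let $\partial_h\in\mathcal{C}^1(L,\mathbb{Z}_2)$ be given by $\partial_h(h)=1$ and $\partial_h(s)=0$ for $s\neq h$. A pseudocoboundary of $L$ is a coboundary $\delta_{\partial_h}$, with $h\in L$, such that $\partial_h((ab)c)\neq\partial_h(a(bc))$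 for some $a,b,c\in L$. A pseudococycle of $L$ is a function $\left(\sum_{s\in S}\delta_{\partial_s}\right)+\psi\in\mathcal{C}^2(L,\mathbb{Z}_2)$, with $S\subseteq L$ and $\psi\in\mathcal{Z}^2(L,\mathbb{Z}_2)$. *)

theory Defs
  imports "HOL-Algebra.Group" "HOL-Library.Z2" "HOL-Library.FuncSet"
begin

locale finite_loop =
  fixes L (structure)
  assumes finite_carrier: "finite (carrier L)"
    and m_closed: "\<lbrakk>a \<in> carrier L; b \<in> carrier L\<rbrakk> \<Longrightarrow> a \<otimes> b \<in> carrier L"
    and one_closed: "\<one> \<in> carrier L"
    and l_one: "a \<in> carrier L \<Longrightarrow> \<one> \<otimes> a = a"
    and r_one: "a \<in> carrier L \<Longrightarrow> a \<otimes> \<one> = a"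
    and left_solution: "\<lbrakk>a \<in> carrier L; b \<in> carrier L\<rbrakk> \<Longrightarrow> \<exists>!x. x \<in> carrier L \<and> a \<otimes> x = b"
    and right_solution: "\<lbrakk>a \<in> carrier L; b \<in> carrier L\<rbrakk> \<Longrightarrow> \<exists>!y. y \<in> carrier L \<and> y \<otimes> a = b"

definition tuples :: "('a, 'm) monoid_scheme \<Rightarrow> nat \<Rightarrow> 'a list set"
  where "tuples L k = {as. length as = k \<and> set as \<subseteq> carrier L}"

text \<open>
  The group of coefficients is the additive group of the field \<^typ>\<open>bit\<close> with two elements.
  Cochains are extensional (fixed to \<^const>\<open>undefined\<close> off the tuples), so that HOL equality
  of cochains is equality of functions on the \<open>k\<close>-th power of \<open>L\<close>.
\<close>

definition cochains :: "('a, 'm) monoid_scheme \<Rightarrow> nat \<Rightarrow> ('a list \<Rightarrow> bit) set"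
  where "cochains L k = tuples L k \<rightarrow>\<^sub>E UNIV"

definition cochain_zero :: "('a, 'm) monoid_scheme \<Rightarrow> nat \<Rightarrow> 'a list \<Rightarrow> bit"
  where "cochain_zero L k = (\<lambda>as\<in>tuples L k. 0)"

text \<open>
  List positions count from 0, so the entries written \<open>a\<^sub>i\<close> and \<open>a\<^sub>i\<^sub>+\<^sub>1\<close> in the usual
  formula are \<open>as ! (i - 1)\<close> and \<open>as ! i\<close>.
\<close>

definition coboundary ::
    "('a, 'm) monoid_scheme \<Rightarrow> nat \<Rightarrow> ('a list \<Rightarrow> bit) \<Rightarrow> 'a list \<Rightarrow> bit"
  where "coboundary L k f = (\<lambda>as\<in>tuples L (k + 1).
     f (take k as) + f (drop 1 as)
     + (\<Sum>i = 1..k. f (take (i - 1) as @ [as ! (i - 1) \<otimes>\<^bsub>L\<^esub> as ! i] @ drop (i + 1) as)))"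

definition cocycles2 :: "('a, 'm) monoid_scheme \<Rightarrow> ('a list \<Rightarrow> bit) set"
  where "cocycles2 L = {\<psi> \<in> cochains L 2. coboundary L 2 \<psi> = cochain_zero L 3}"

definition loop_cocycle :: "('a, 'm) monoid_scheme \<Rightarrow> ('a list \<Rightarrow> bit) \<Rightarrow> bool"
  where "loop_cocycle L \<psi> \<longleftrightarrow> \<psi> \<in> cochains L 2 \<and>
     (\<exists>f \<in> cochains L 1. coboundary L 2 \<psi> = coboundary L 2 (coboundary L 1 f))"

definition point_cochain :: "('a, 'm) monoid_scheme \<Rightarrow> 'a \<Rightarrow> 'a list \<Rightarrow> bit"
  where "point_cochain L h = (\<lambda>as\<in>tuples L 1. if as = [h] then 1 else 0)"

definition pseudocoboundary :: "('a, 'm) monoid_scheme \<Rightarrow> ('a list \<Rightarrow> bit) \<Rightarrow> bool"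
  where "pseudocoboundary L \<phi> \<longleftrightarrow> (\<exists>h \<in> carrier L. \<phi> = coboundary L 1 (point_cochain L h) \<and>
     (\<exists>a \<in> carrier L. \<exists>b \<in> carrier L. \<exists>c \<in> carrier L.
        point_cochain L h [(a \<otimes>\<^bsub>L\<^esub> b) \<otimes>\<^bsub>L\<^esub> c] \<noteq> point_cochain L h [a \<otimes>\<^bsub>L\<^esub> (b \<otimes>\<^bsub>L\<^esub> c)]))"

definition pseudococycle :: "('a, 'm) monoid_scheme \<Rightarrow> ('a list \<Rightarrow> bit) \<Rightarrow> bool"
  where "pseudococycle L \<phi> \<longleftrightarrow> (\<exists>S \<psi>. S \<subseteq> carrier L \<and> \<psi> \<in> cocycles2 L \<and>
     \<phi> = (\<lambda>as\<in>tuples L 2. (\<Sum>s\<in>S. coboundary L 1 (point_cochain L s) as) + \<psi> as))"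

end

theory Submission
  imports Defs
begin

text \<open>
  The coboundary operator is additive, so the sum over \<open>S\<close> of the coboundaries of the point
  cochains is the coboundary of a single 1-cochain \<open>f\<close>, and adding a 2-cocycle does not change
  its coboundary. Hence \<open>f\<close> witnesses the loop-cocycle condition.
\<close>

lemma coboundary_in_cochains: "coboundary L k f \<in> cochains L (k + 1)"
  by (simp add: coboundary_def cochains_def)

context finite_loop
begin

lemma take_in_tuples: "as \<in> tuples L (k + 1) \<Longrightarrow> take k as \<in> tuples L k"
  using set_take_subset[of k as] by (auto simp: tuples_def)

lemma drop_in_tuples: "as \<in> tuples L (k + 1) \<Longrightarrow> drop 1 as \<in> tuples L k"
  using set_drop_subset[of 1 as] by (auto simp: tuples_def)

text \<open>The bounds on \<open>i\<close> make positions \<open>i - 1\<close> and \<open>i\<close>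
  both valid in a tuple of length \<open>k + 1\<close>; merging them leaves (i - 1) + 1 + (k - i) =
  k entries, and \<open>m_closed\<close> keeps the product in the carrier.\<close>

lemma contract_in_tuples:
  assumes as: "as \<in> tuples L (k + 1)" and i: "i \<in> {1..k}"
  shows "take (i - 1) as @ [as ! (i - 1) \<otimes> as ! i] @ drop (i + 1) as \<in> tuples L k"
proof -
  have "as ! (i - 1) \<in> carrier L" "as ! i \<in> carrier L"
    using as i nth_mem[of "i - 1" as] nth_mem[of i as] by (auto simp: tuples_def)
  then show ?thesis
    using as i set_take_subset[of "i - 1" as] set_drop_subset[of "i + 1" as] m_closed
    by (auto simp: tuples_def)
qed

lemma coboundary_add:
  "coboundary L k (\<lambda>as\<in>tuples L k. f as + g as) =
   (\<lambda>as\<in>tuples L (k + 1). coboundary L k f as + coboundary L k g as)"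
\<comment> \<open>Unfolds only the coboundary on the left, so that two restricted functions remain
  to be compared at a single tuple.\<close>
proof (rule restrict_ext[THEN trans[OF coboundary_def]])
  fix as assume as: "as \<in> tuples L (k + 1)"
  let ?c = "\<lambda>i. take (i - 1) as @ [as ! (i - 1) \<otimes> as ! i] @ drop (i + 1) as"
  let ?h = "\<lambda>as\<in>tuples L k. f as + g as"
  \<comment> \<open>Each contraction is again a \<open>k\<close>-tuple, so the restriction in
    \<open>?h\<close> never yields \<open>undefined\<close> here.\<close>
  have "(\<Sum>i = 1..k. ?h (?c i)) = (\<Sum>i = 1..k. f (?c i) + g (?c i))"
    by (rule sum.cong[OF refl], rule restrict_apply'[OF contract_in_tuples[OF as]])
  then have "(\<Sum>i = 1..k. ?h (?c i)) = (\<Sum>i = 1..k. f (?c i)) + (\<Sum>i = 1..k. g (?c i))"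
    by (simp only: sum.distrib)
  then show "?h (take k as) + ?h (drop 1 as) + (\<Sum>i = 1..k. ?h (?c i)) =
      coboundary L k f as + coboundary L k g as"
    unfolding coboundary_def restrict_apply'[OF as]
      restrict_apply'[OF take_in_tuples[OF as]] restrict_apply'[OF drop_in_tuples[OF as]]
    by (simp only: ac_simps)
qed

text \<open>Exchanging the sum over \<open>S\<close> with the sum over contractions gives this
  directly, without induction on \<open>S\<close>.\<close>

lemma coboundary_sum:
  "coboundary L k (\<lambda>as\<in>tuples L k. \<Sum>s\<in>S. f s as) =
   (\<lambda>as\<in>tuples L (k + 1). \<Sum>s\<in>S. coboundary L k (f s) as)"
proof (rule restrict_ext[THEN trans[OF coboundary_def]])
  fix as assume as: "as \<in> tuples L (k + 1)"
  let ?c = "\<lambda>i. take (i - 1) as @ [as ! (i - 1) \<otimes> as ! i] @ drop (i + 1) as"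
  let ?h = "\<lambda>as\<in>tuples L k. \<Sum>s\<in>S. f s as"
  have "(\<Sum>i = 1..k. ?h (?c i)) = (\<Sum>i = 1..k. \<Sum>s\<in>S. f s (?c i))"
    by (rule sum.cong[OF refl], rule restrict_apply'[OF contract_in_tuples[OF as]])
  also have "\<dots> = (\<Sum>s\<in>S. \<Sum>i = 1..k. f s (?c i))"
    by (rule sum.swap)
  finally show "?h (take k as) + ?h (drop 1 as) + (\<Sum>i = 1..k. ?h (?c i)) =
      (\<Sum>s\<in>S. coboundary L k (f s) as)"
    unfolding coboundary_def restrict_apply'[OF as]
      restrict_apply'[OF take_in_tuples[OF as]] restrict_apply'[OF drop_in_tuples[OF as]]
    by (simp only: sum.distrib)
qed

lemma loop_cocycle_coboundary:
  "f \<in> cochains L 1 \<Longrightarrow> loop_cocycle L (coboundary L 1 f)"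
  \<comment> \<open>The witness is \<open>f\<close> itself; \<open>one_add_one\<close> turns the
    degree \<open>1 + 1\<close> into \<open>2\<close>.\<close>
  using coboundary_in_cochains[of L 1 f] unfolding loop_cocycle_def one_add_one by blast

lemma pseudocoboundary_imp_loop_cocycle:
  assumes "pseudocoboundary L \<phi>"
  shows "loop_cocycle L \<phi>"
proof -
  obtain h where "\<phi> = coboundary L 1 (point_cochain L h)"
    using assms by (auto simp: pseudocoboundary_def)
  moreover have "point_cochain L h \<in> cochains L 1"
    by (simp add: point_cochain_def cochains_def)
  ultimately show ?thesis
    by (simp only: loop_cocycle_coboundary)
qed

lemma pseudococycle_imp_loop_cocycle:
  assumes "pseudococycle L \<phi>"
  shows "loop_cocycle L \<phi>"
proof -
  obtain S \<psi> where \<psi>: "\<psi> \<in> cocycles2 L"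
    and \<phi>: "\<phi> = (\<lambda>as\<in>tuples L 2. (\<Sum>s\<in>S. coboundary L 1 (point_cochain L s) as) + \<psi> as)"
    using assms by (auto simp: pseudococycle_def)
  define f where "f = (\<lambda>as\<in>tuples L 1. \<Sum>s\<in>S. point_cochain L s as)"
  have f: "f \<in> cochains L 1"
    by (simp add: f_def cochains_def)
  have df: "coboundary L 1 f = (\<lambda>as\<in>tuples L 2. \<Sum>s\<in>S. coboundary L 1 (point_cochain L s) as)"
    unfolding f_def coboundary_sum one_add_one ..
  have \<phi>_eq: "\<phi> = (\<lambda>as\<in>tuples L 2. coboundary L 1 f as + \<psi> as)"
    unfolding \<phi> df by (rule restrict_ext) simp
  have "coboundary L 2 \<phi> =
      (\<lambda>as\<in>tuples L (2 + 1). coboundary L 2 (coboundary L 1 f) as + coboundary L 2 \<psi> as)"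
    unfolding \<phi>_eq by (rule coboundary_add)
  \<comment> \<open>The coboundary of \<open>\<psi>\<close> is \<open>cochain_zero L 3\<close>,
    whose value is 0 only on 3-tuples; hence the pointwise argument under the restriction.\<close>
  also have "\<dots> = (\<lambda>as\<in>tuples L (2 + 1). coboundary L 2 (coboundary L 1 f) as)"
    using \<psi> by (intro restrict_ext) (simp add: cocycles2_def cochain_zero_def)
  \<comment> \<open>A coboundary is already extensional, so restricting it to its own tuples changes
    nothing.\<close>
  also have "\<dots> = coboundary L 2 (coboundary L 1 f)"
    using coboundary_in_cochains unfolding cochains_def by (rule PiE_restrict)
  finally show ?thesis
    using f unfolding loop_cocycle_def by (auto simp: \<phi> cochains_def)
qed

end

theorem proposition2p3:
  fixes L :: "('a, 'm) monoid_scheme"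
  assumes "finite_loop L"
  shows "(\<forall>\<phi>. pseudocoboundary L \<phi> \<longrightarrow> loop_cocycle L \<phi>) \<and>
         (\<forall>\<phi>. pseudococycle L \<phi> \<longrightarrow> loop_cocycle L \<phi>)"
  using finite_loop.pseudocoboundary_imp_loop_cocycle[OF assms]
    finite_loop.pseudococycle_imp_loop_cocycle[OF assms] by blast

end
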